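(* Let $S=\{s_1,\dots,s_6\}\subset\mathbb{R}^4$ be six points in general linear position, and let $u_1,\dots,u_4$ be the unit vectors associated to $S$ and to a double covering $T_1,\dots,T_4$ as in the context. Let $$R(x)=\langle x,u_1\rangle\langle x,u_2\rangle\langle x,u_3\rangle\langle x,u_4\rangle .$$ Then $R$ is not in $I^{[2]}_4(S)$.
   Context: $P_{4,m}$ is the real vector space of forms of degree $m$ in $4$ variables; $I_{1,2}(S)=\{p\in P_{4,2} : p(s)=0\ \forall s\in S\}$; $I^{[2]}_4(S)\subseteq P_{4,4}$ is the linear span of the squares $q^2$, $q\in I_{1,2}(S)$. General linear position means any four of the six vectors $s_1,\dots,s_6$ are linearly independent. $\langle\cdot,\cdot\rangle$ is the standard inner product. Double covering: $T_1,T_2,T_3,T_4$ are 3-element subsets of $\{1,\dots,6\}$ such that any two of them intersect in exactly one element and each element of $\{1,\dots,6\}$ lies in precisely two of them (for example $\{1,2,3\},\{1,4,5\},\{2,4,6\},\{3,5,6\}$). For a triple $T=\{t_1,t_2,t_3\}$, $L_T$ is the hyperplane spanned by $s_{t_1},s_{t_2},s_{t_3}$. $u_i$ is a unit vector perpendicular to $L_{T_i}$ (sign chosen arbitrarily). *)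

theory Defs
  imports "HOL-Analysis.Analysis" "HOL-Library.Function_Algebras"
begin

(* Pointwise scalar multiplication, so that span applies to sets of real-valued functions. *)
instantiation "fun" :: (type, real_vector) real_vector
begin

definition "scaleR c f = (\<lambda>x. c *\<^sub>R f x)"

instance
  by standard (simp_all add: scaleR_fun_def fun_eq_iff scaleR_add_left scaleR_add_right)

end

(* P_{4,m}.  A form over the infinite field of reals is identified with the polynomial
   function it induces. *)
definition forms :: "nat \<Rightarrow> (real ^ 4 \<Rightarrow> real) set" where
  "forms m = span {(\<lambda>x. \<Prod>i\<in>UNIV. (x $ i) ^ a i) | a :: 4 \<Rightarrow> nat. (\<Sum>i\<in>UNIV. a i) = m}"

(* I_{1,2}(S) *)
definition vanishing_quadrics :: "(real ^ 4) set \<Rightarrow> (real ^ 4 \<Rightarrow> real) set" where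
  "vanishing_quadrics S = {p \<in> forms 2. \<forall>s\<in>S. p s = 0}"

(* I^{[2]}_4(S) *)
definition squares_span :: "(real ^ 4) set \<Rightarrow> (real ^ 4 \<Rightarrow> real) set" where
  "squares_span S = span {(\<lambda>x. (q x)\<^sup>2) | q. q \<in> vanishing_quadrics S}"

definition general_linear_position :: "(real ^ 4) set \<Rightarrow> bool" where
  "general_linear_position S \<longleftrightarrow> (\<forall>A \<subseteq> S. card A = 4 \<longrightarrow> independent A)"

definition double_covering :: "(nat \<Rightarrow> nat set) \<Rightarrow> bool" where
  "double_covering T \<longleftrightarrow>
     (\<forall>i\<in>{1..4}. T i \<subseteq> {1..6} \<and> card (T i) = 3) \<and>
     (\<forall>i\<in>{1..4}. \<forall>j\<in>{1..4}. i \<noteq> j \<longrightarrow> card (T i \<inter> T j) = 1) \<and>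
     (\<forall>k\<in>{1..6}. card {i\<in>{1..4}. k \<in> T i} = 2)"

(* L_{T_i} is span (s ` T i); the choice of sign of u i stays free. *)
definition unit_normals ::
  "(nat \<Rightarrow> real ^ 4) \<Rightarrow> (nat \<Rightarrow> nat set) \<Rightarrow> (nat \<Rightarrow> real ^ 4) \<Rightarrow> bool" where
  "unit_normals s T u \<longleftrightarrow>
     (\<forall>i\<in>{1..4}. norm (u i) = 1 \<and> (\<forall>x \<in> span (s ` T i). orthogonal (u i) x))"

end

theory Submission
  imports Defs
begin

text \<open>
Suppose that \<open>R = \<Sum> c\<^sub>m q\<^sub>m\<^sup>2\<close>, where the quadrics \<open>q\<^sub>m\<close> vanish on \<open>S\<close>. Collect the polar forms of the \<open>q\<^sub>m\<close>
into one symmetric bilinear map \<open>\<beta>\<close> with values in the coefficient vectors indexed by \<open>m\<close>, and let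
\<open>g\<close> be the (indefinite) diagonal form with entries \<open>c\<^sub>m\<close>. Then \<open>R x = g (\<beta> x x) (\<beta> x x)\<close>, and
\<open>\<beta> s s = 0\<close> for every \<open>s \<in> S\<close>. The vanishing of \<open>R\<close> on the
hyperplanes \<open>L\<^sub>1, L\<^sub>2, L\<^sub>3\<close> makes \<open>g\<close> zero on all values of \<open>\<beta>\<close>, so that \<open>R = 0\<close>. This is
absurd, because a product of four nonzero linear forms is not the zero function.

There are two steps. A hyperplane \<open>L\<close> on which \<open>R\<close> vanishes is spanned by three points \<open>p, q, r\<close>
of \<open>S\<close>. As \<open>\<beta> p p = \<beta> q q = \<beta> r r = 0\<close>, the values of \<open>\<beta>\<close> on \<open>L\<close> are combinations of
\<open>\<beta> q r, \<beta> p r, \<beta> p q\<close>, and comparing the coefficients of the quartic \<open>R\<close> restricted to \<open>L\<close> shows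
that \<open>g\<close> is zero on all pairs of them (lemma \<open>isotropic_on_plane\<close>).

Write \<open>L\<^sub>1 = span {x\<^sub>2, x\<^sub>3, y\<^sub>1}\<close>, \<open>L\<^sub>2 = span {x\<^sub>1, x\<^sub>3, y\<^sub>2}\<close>, \<open>L\<^sub>3 = span {x\<^sub>1, x\<^sub>2, y\<^sub>3}\<close>, so that
\<open>x\<^sub>k\<close> is the point common to the two hyperplanes other than \<open>L\<^sub>k\<close>, and let \<open>v\<close> be a
nonzero vector in \<open>L\<^sub>1 \<inter> L\<^sub>2 \<inter> L\<^sub>3\<close>. General position makes \<open>v, x\<^sub>1, x\<^sub>2, x\<^sub>3\<close> a basis. Within \<open>L\<^sub>1\<close> the
equation \<open>\<beta> y\<^sub>1 y\<^sub>1 = 0\<close> expresses \<open>\<beta> x\<^sub>2 x\<^sub>3\<close> by \<open>\<beta> v v, \<beta> v x\<^sub>2, \<beta> v x\<^sub>3\<close> (lemma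
\<open>polar_value_in_span_apex\<close>), and likewise in \<open>L\<^sub>2\<close> and \<open>L\<^sub>3\<close>. Hence all values of \<open>\<beta>\<close> are spanned by
\<open>\<beta> v v, \<beta> v x\<^sub>1, \<beta> v x\<^sub>2, \<beta> v x\<^sub>3\<close>. Any two of \<open>v, x\<^sub>1, x\<^sub>2, x\<^sub>3\<close> lie with \<open>v\<close> in one common hyperplane
\<open>L\<^sub>k\<close>, where the first step applies, so \<open>g\<close> is zero on every pair of these four generators. The
argument does not distinguish the case of a fourth hyperplane through \<open>v\<close>, in which the
vectors \<open>u\<^sub>i\<close> are linearly dependent, from the generic case of a coordinate tetrahedron.
\<close>

section \<open>Spans and bilinear maps\<close>

lemma span_3_iff:
  fixes p q r x :: "'a::real_vector"
  shows "x \<in> span {p, q, r} \<longleftrightarrow> (\<exists>a b c. x = a *\<^sub>R p + b *\<^sub>R q + c *\<^sub>R r)"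
proof
  assume "x \<in> span {p, q, r}"
  then obtain a b c where "x - a *\<^sub>R p - b *\<^sub>R q - c *\<^sub>R r \<in> span {}"
    unfolding span_breakdown_eq by blast
  then have "x = a *\<^sub>R p + b *\<^sub>R q + c *\<^sub>R r"
    by (simp add: algebra_simps)
  then show "\<exists>a b c. x = a *\<^sub>R p + b *\<^sub>R q + c *\<^sub>R r" by blast
qed (auto intro: span_add span_scale span_base)

lemma scaleR_in_span_cancel:
  fixes x :: "'a::real_vector"
  assumes "t *\<^sub>R x \<in> span A" "t \<noteq> 0"
  shows "x \<in> span A"
  using span_scale[OF assms(1), of "inverse t"] assms(2) by simp

lemma bilinear_values_in_span:
  assumes "bilinear h" "x \<in> span B" "y \<in> span C"
    and D: "\<And>b c. b \<in> B \<Longrightarrow> c \<in> C \<Longrightarrow> h b c \<in> span D"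
  shows "h x y \<in> span D"
proof -
  have 1: "h b y \<in> span D" if "b \<in> B" for b
    using assms(3)
  proof (induction rule: span_induct_alt)
    case base
    then show ?case by (simp add: bilinear_rzero[OF assms(1)] span_zero)
  next
    case (step c z w)
    then show ?case
      using D[OF that] by (simp add: bilinear_radd[OF assms(1)] bilinear_rmul[OF assms(1)] span_add span_scale)
  qed
  show ?thesis
    using assms(2)
  proof (induction rule: span_induct_alt)
    case base
    then show ?case by (simp add: bilinear_lzero[OF assms(1)] span_zero)
  next
    case (step c z w)
    then show ?case
      using 1 by (simp add: bilinear_ladd[OF assms(1)] bilinear_lmul[OF assms(1)] span_add span_scale)
  qed
qed

lemma bilinear_vanishes_on_span:
  assumes "bilinear h" "x \<in> span B" "y \<in> span C"
    and "\<And>b c. b \<in> B \<Longrightarrow> c \<in> C \<Longrightarrow> h b c = 0"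
  shows "h x y = 0"
  using bilinear_values_in_span[of h x B y C "{}"] assms by simp

section \<open>Quartics with a Gram representation\<close>

text \<open>A linear combination of squares of quadrics is handled through the vector of their polar
forms. No definiteness of \<open>g\<close> can be asked for, as the coefficients of the squares may have
either sign.\<close>

locale gram_form =
  fixes \<beta> :: "'v::real_vector \<Rightarrow> 'v \<Rightarrow> 'e::real_vector" and g :: "'e \<Rightarrow> 'e \<Rightarrow> real"
  assumes \<beta>: "bilinear \<beta>" and sym: "\<beta> x y = \<beta> y x"
    and g: "bilinear g" and gsym: "g a b = g b a"
begin

definition quartic :: "'v \<Rightarrow> real" where
  "quartic x = g (\<beta> x x) (\<beta> x x)"

text \<open>At \<open>t\<^sub>1 p + t\<^sub>2 q + t\<^sub>3 r\<close> the quartic is, up to the factor 4, the \<open>g\<close>-square of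
\<open>t\<^sub>2t\<^sub>3 \<beta> q r + t\<^sub>1t\<^sub>3 \<beta> p r + t\<^sub>1t\<^sub>2 \<beta> p q\<close>. The six products of two of the monomials \<open>t\<^sub>2t\<^sub>3\<close>,
\<open>t\<^sub>1t\<^sub>3\<close>, \<open>t\<^sub>1t\<^sub>2\<close> are linearly independent, so every coefficient has to vanish: three points with
one zero coordinate isolate the pure terms, and three sign patterns isolate the mixed ones.\<close>

lemma isotropic_on_plane:
  assumes zero: "\<beta> p p = 0" "\<beta> q q = 0" "\<beta> r r = 0"
    and van: "\<And>x. x \<in> span {p, q, r} \<Longrightarrow> quartic x = 0"
    and mem: "x \<in> span {p, q, r}" "y \<in> span {p, q, r}" "z \<in> span {p, q, r}" "w \<in> span {p, q, r}"
  shows "g (\<beta> x y) (\<beta> z w) = 0"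
proof -
  let ?y = "\<lambda>t1 t2 t3. (t2 * t3) *\<^sub>R \<beta> q r + (t1 * t3) *\<^sub>R \<beta> p r + (t1 * t2) *\<^sub>R \<beta> p q"
  define D where "D = {\<beta> q r, \<beta> p r, \<beta> p q}"
  have D: "\<beta> x y \<in> span D" if "x \<in> span {p, q, r}" "y \<in> span {p, q, r}" for x y
    using \<beta> that
  proof (rule bilinear_values_in_span)
    fix b c assume "b \<in> {p, q, r}" "c \<in> {p, q, r}"
    then show "\<beta> b c \<in> span D"
      using zero by (auto simp: D_def sym[of q p] sym[of r p] sym[of r q] span_zero intro: span_base)
  qed
  have expand: "g (?y t1 t2 t3) (?y t1 t2 t3) = 0" for t1 t2 t3
  proof -
    let ?x = "t1 *\<^sub>R p + t2 *\<^sub>R q + t3 *\<^sub>R r"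
    have "\<beta> ?x ?x = 2 *\<^sub>R ?y t1 t2 t3"
      using zero
      by (simp add: bilinear_ladd[OF \<beta>] bilinear_radd[OF \<beta>] bilinear_lmul[OF \<beta>] bilinear_rmul[OF \<beta>]
          sym[of q p] sym[of r p] sym[of r q] algebra_simps flip: scaleR_add_left)
    moreover have "g (\<beta> ?x ?x) (\<beta> ?x ?x) = 0"
      by (fold quartic_def, intro van) (auto simp: span_3_iff)
    ultimately show ?thesis
      by (simp only: bilinear_lmul[OF g] bilinear_rmul[OF g]) simp
  qed
  have pure: "g (\<beta> q r) (\<beta> q r) = 0" "g (\<beta> p r) (\<beta> p r) = 0" "g (\<beta> p q) (\<beta> p q) = 0"
    using expand[of 0 1 1] expand[of 1 0 1] expand[of 1 1 0] by simp_all
  note gsyms = gsym[of "\<beta> p r" "\<beta> q r"] gsym[of "\<beta> p q" "\<beta> q r"] gsym[of "\<beta> p q" "\<beta> p r"]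
  have mixed: "g (\<beta> p r) (\<beta> p q) = 0" "g (\<beta> q r) (\<beta> p q) = 0" "g (\<beta> q r) (\<beta> p r) = 0"
    using expand[of 1 1 1] expand[of "-1" 1 1] expand[of 1 "-1" 1] pure
    by (simp_all add: bilinear_ladd[OF g] bilinear_radd[OF g] bilinear_lmul[OF g] bilinear_rmul[OF g]
          bilinear_lneg[OF g] bilinear_rneg[OF g] bilinear_lsub[OF g] bilinear_rsub[OF g] gsyms)
  show ?thesis
    by (rule bilinear_vanishes_on_span[OF g D D, OF mem])
      (auto simp: D_def pure mixed gsyms)
qed

text \<open>Write \<open>c r = v - a p - b q\<close>. Then \<open>\<beta> r r = 0\<close> becomes a linear relation between \<open>\<beta> v v\<close>,
\<open>\<beta> v p\<close>, \<open>\<beta> v q\<close> and \<open>\<beta> p q\<close>, in which the last has the coefficient \<open>2 a b\<close>. The subspaces \<open>M\<close> and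
\<open>N\<close>, in the application two other hyperplanes through \<open>v\<close>, serve to make \<open>a\<close> and \<open>b\<close> nonzero:
as \<open>v \<notin> span {p, q}\<close> gives \<open>c \<noteq> 0\<close>, the assumption \<open>a = 0\<close> would put \<open>r\<close> into every subspace
that contains \<open>v\<close> and \<open>q\<close>, and \<open>b = 0\<close> into every one that contains \<open>v\<close> and \<open>p\<close>.\<close>

lemma polar_value_in_span_apex:
  assumes zero: "\<beta> p p = 0" "\<beta> q q = 0" "\<beta> r r = 0"
    and v: "v \<in> span {p, q, r}" "v \<notin> span {p, q}"
    and M: "subspace M" "v \<in> M" "q \<in> M" "r \<notin> M"
    and N: "subspace N" "v \<in> N" "p \<in> N" "r \<notin> N"
  shows "\<beta> p q \<in> span {\<beta> v v, \<beta> v p, \<beta> v q}"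
proof -
  obtain a b c where v_eq: "v = a *\<^sub>R p + b *\<^sub>R q + c *\<^sub>R r"
    using v(1) by (auto simp: span_3_iff)
  have "c \<noteq> 0"
  proof
    assume "c = 0"
    with v_eq have "v \<in> span {p, q}" by (auto intro: span_add span_scale span_base)
    with v(2) show False ..
  qed
  have "a \<noteq> 0"
  proof
    assume "a = 0"
    then have "r = inverse c *\<^sub>R (v - b *\<^sub>R q)" using v_eq \<open>c \<noteq> 0\<close> by simp
    then show False using M by (metis subspace_scale subspace_diff)
  qed
  have "b \<noteq> 0"
  proof
    assume "b = 0"
    then have "r = inverse c *\<^sub>R (v - a *\<^sub>R p)" using v_eq \<open>c \<noteq> 0\<close> by simp
    then show False using N by (metis subspace_scale subspace_diff)
  qed
  have "v - a *\<^sub>R p - b *\<^sub>R q = c *\<^sub>R r" using v_eq by simp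
  then have "\<beta> (v - a *\<^sub>R p - b *\<^sub>R q) (v - a *\<^sub>R p - b *\<^sub>R q) = 0"
    using zero by (simp add: bilinear_lmul[OF \<beta>] bilinear_rmul[OF \<beta>])
  then have "(2 * a * b) *\<^sub>R \<beta> p q = (-1) *\<^sub>R \<beta> v v + (2 * a) *\<^sub>R \<beta> v p + (2 * b) *\<^sub>R \<beta> v q"
    using zero
    by (simp add: bilinear_ladd[OF \<beta>] bilinear_radd[OF \<beta>] bilinear_lsub[OF \<beta>] bilinear_rsub[OF \<beta>] bilinear_lmul[OF \<beta>] bilinear_rmul[OF \<beta>]
        sym[of p v] sym[of q v] sym[of q p] algebra_simps flip: scaleR_add_left)
  then have "(2 * a * b) *\<^sub>R \<beta> p q \<in> span {\<beta> v v, \<beta> v p, \<beta> v q}"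
    unfolding span_3_iff by blast
  then show ?thesis
    using scaleR_in_span_cancel[of "2 * a * b"] \<open>a \<noteq> 0\<close> \<open>b \<noteq> 0\<close> by auto
qed

end

section \<open>Gram representation of sums of squares of quadrics\<close>

lemma degree_two_exponents:
  fixes a b c d :: nat
  assumes "a + b + c + d = 2"
  shows "(a,b,c,d) \<in> {(2,0,0,0),(0,2,0,0),(0,0,2,0),(0,0,0,2),(1,1,0,0),(1,0,1,0),(1,0,0,1),
     (0,1,1,0),(0,1,0,1),(0,0,1,1)}"
proof -
  have "a \<in> {0,1,2}" "b \<in> {0,1,2}" "c \<in> {0,1,2}" using assms by auto
  then show ?thesis using assms by (elim insertE emptyE) simp_all
qed

lemma quadratic_form_has_polar_form:
  assumes "q \<in> forms 2"
  shows "\<exists>B. bilinear B \<and> (\<forall>x y. B x y = B y x) \<and> (\<forall>x. q x = B x x)"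
  using assms unfolding forms_def
proof (induction rule: span_induct_alt)
  case base
  show ?case by (intro exI[of _ "\<lambda>_ _. 0"]) (simp add: bilinear_def linear_iff)
next
  case (step c m q)
  then obtain B where B: "bilinear B" "\<forall>x y. B x y = B y x" "\<forall>x. q x = B x x" by blast
  from step(1) obtain a :: "4 \<Rightarrow> nat" where a: "(\<Sum>i\<in>UNIV. a i) = 2"
    and m: "m = (\<lambda>x. \<Prod>i\<in>UNIV. (x $ i) ^ a i)" by blast
  have "\<exists>k l. \<forall>x. m x = x $ k * x $ l"
    using degree_two_exponents[of "a 1" "a 2" "a 3" "a 4"] a
    unfolding m sum_4 UNIV_4 by (auto simp: power2_eq_square) (rule exI, rule exI, rule allI, rule refl)+
  then obtain k l where kl: "\<And>x. m x = x $ k * x $ l" by blast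
  let ?C = "\<lambda>x y. c * ((x $ k * y $ l + x $ l * y $ k) / 2) + B x y"
  have "bilinear ?C"
    using B(1) by (simp add: bilinear_def linear_iff algebra_simps add_divide_distrib)
  then show ?case
    using B(2,3) kl by (intro exI[of _ ?C]) (auto simp: scaleR_fun_def)
qed

lemma sum_fun_apply: "(sum f A) x = (\<Sum>a\<in>A. f a x)"
  by (induction A rule: infinite_finite_induct) auto

text \<open>The coordinates of \<open>\<beta>\<close> are indexed by the squares themselves. Outside the finite set \<open>A\<close> of
squares that occur they are set to zero, as there is no polar form \<open>B w\<close> to choose for such a \<open>w\<close>.\<close>

lemma squares_span_gram_form:
  assumes "f \<in> squares_span S"
  shows "\<exists>(\<beta> :: real ^ 4 \<Rightarrow> real ^ 4 \<Rightarrow> (real ^ 4 \<Rightarrow> real) \<Rightarrow> real) g.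
    gram_form \<beta> g \<and> (\<forall>s\<in>S. \<beta> s s = 0) \<and> gram_form.quartic \<beta> g = f"
proof -
  obtain A c where A: "finite A" "A \<subseteq> {(\<lambda>x. (q x)\<^sup>2) | q. q \<in> vanishing_quadrics S}"
    and f: "f = (\<Sum>w\<in>A. c w *\<^sub>R w)"
    using assms unfolding squares_span_def span_explicit by blast
  have "\<exists>B. bilinear B \<and> (\<forall>x y. B x y = B y x) \<and> (\<forall>s\<in>S. B s s = 0) \<and> (\<forall>x. w x = (B x x)\<^sup>2)"
    if w: "w \<in> A" for w
  proof -
    have "w \<in> {(\<lambda>x. (q x)\<^sup>2) | q. q \<in> vanishing_quadrics S}"
      using A(2) w by (rule subsetD)
    then obtain q where q: "w = (\<lambda>x. (q x)\<^sup>2)" "q \<in> forms 2" "\<forall>s\<in>S. q s = 0"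
      unfolding vanishing_quadrics_def mem_Collect_eq by blast
    obtain B where "bilinear B" "\<forall>x y. B x y = B y x" "\<forall>x. q x = B x x"
      using quadratic_form_has_polar_form[OF q(2)] by blast
    then show ?thesis
      using q(1,3) by (intro exI[of _ B]) simp
  qed
  then have "\<forall>w\<in>A. \<exists>B. bilinear B \<and> (\<forall>x y. B x y = B y x) \<and> (\<forall>s\<in>S. B s s = 0) \<and>
      (\<forall>x. w x = (B x x)\<^sup>2)" by blast
  then obtain B where B: "\<forall>w\<in>A. bilinear (B w) \<and> (\<forall>x y. B w x y = B w y x) \<and>
      (\<forall>s\<in>S. B w s s = 0) \<and> (\<forall>x. w x = (B w x x)\<^sup>2)"
    by (rule bchoice[THEN exE])
  define \<beta> where "\<beta> = (\<lambda>x y w. if w \<in> A then B w x y else 0)"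
  define g where "g = (\<lambda>a b. \<Sum>w\<in>A. c w * (a w * b w) :: real)"
  interpret gram_form \<beta> g
  proof
    show "bilinear \<beta>"
      using B by (auto simp: \<beta>_def bilinear_def linear_iff fun_eq_iff scaleR_fun_def)
    show "bilinear g"
      by (auto simp: g_def bilinear_def linear_iff scaleR_fun_def algebra_simps sum.distrib sum_distrib_left)
    show "\<beta> x y = \<beta> y x" for x y using B by (auto simp: \<beta>_def fun_eq_iff)
    show "g a b = g b a" for a b by (simp add: g_def mult.commute)
  qed
  have "\<forall>s\<in>S. \<beta> s s = 0" using B by (auto simp: \<beta>_def fun_eq_iff)
  moreover have "quartic x = f x" for x
    unfolding quartic_def using B
    by (auto simp: f g_def \<beta>_def sum_fun_apply scaleR_fun_def power2_eq_square intro!: sum.cong)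
  ultimately show ?thesis
    using gram_form_axioms by (intro exI[of _ \<beta>] exI[of _ g]) auto
qed

section \<open>Three hyperplanes through six points in general position\<close>

lemma general_linear_position_tuple:
  assumes "general_linear_position S" "{a, b, c, d} \<subseteq> S" "distinct [a, b, c, d]"
  shows "independent {a, b, c}" and "d \<notin> span {a, b, c}"
    and "\<exists>n. span {a, b, c} = {x. orthogonal n x}"
proof -
  have "card {a, b, c, d} = 4" using assms(3) by auto
  then have "independent {a, b, c, d}"
    using assms(1,2) unfolding general_linear_position_def by blast
  then show indep: "independent {a, b, c}"
    by (rule independent_mono) auto
  have "{a, b, c, d} - {d} = {a, b, c}" using assms(3) by auto
  with \<open>independent {a, b, c, d}\<close> show "d \<notin> span {a, b, c}"
    unfolding dependent_def by fastforce
  have "card {a, b, c} = 3" using assms(3) by auto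
  then have "dim {a, b, c} = DIM(real ^ 4) - 1"
    using indep by (simp add: dim_eq_card_independent)
  then obtain n where "span {a, b, c} = {x. n \<bullet> x = 0}"
    using lowdim_eq_hyperplane[of "{a, b, c}"] by blast
  then show "\<exists>n. span {a, b, c} = {x. orthogonal n x}" by (auto simp: orthogonal_def)
qed

text \<open>All values of \<open>\<beta>\<close> lie in the span of \<open>\<beta> v v, \<beta> v x1, \<beta> v x2, \<beta> v x3\<close> for a vector \<open>v\<close> common
to the three hyperplanes, and \<open>g\<close> is zero on every pair of these four.\<close>

lemma quartic_vanishing_on_three_hyperplanes:
  assumes "gram_form \<beta> g"
    and glp: "general_linear_position S"
    and zero: "\<forall>s\<in>S. \<beta> s s = 0"
    and S: "{x1, x2, x3, y1, y2, y3} \<subseteq> S"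
    and dist: "distinct [x1, x2, x3, y1, y2, y3]"
    and van: "\<And>x. x \<in> span {x2, x3, y1} \<union> span {x1, x3, y2} \<union> span {x1, x2, y3} \<Longrightarrow>
      gram_form.quartic \<beta> g x = 0"
  shows "gram_form.quartic \<beta> g x = 0"
proof -
  interpret gram_form \<beta> g by fact
  let ?L1 = "span {x2, x3, y1}" and ?L2 = "span {x1, x3, y2}" and ?L3 = "span {x1, x2, y3}"
  note tuple = general_linear_position_tuple[OF glp]
  have z: "\<beta> x1 x1 = 0" "\<beta> x2 x2 = 0" "\<beta> x3 x3 = 0" "\<beta> y1 y1 = 0" "\<beta> y2 y2 = 0" "\<beta> y3 y3 = 0"
    using zero S by auto
  have "\<exists>n. ?L1 = {x. orthogonal n x}"
    by (rule tuple(3)[where d = x1]) (use S dist in auto)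
  then obtain n1 where n1: "?L1 = {x. orthogonal n1 x}" ..
  have "\<exists>n. ?L2 = {x. orthogonal n x}"
    by (rule tuple(3)[where d = x2]) (use S dist in auto)
  then obtain n2 where n2: "?L2 = {x. orthogonal n2 x}" ..
  have "\<exists>n. ?L3 = {x. orthogonal n x}"
    by (rule tuple(3)[where d = x3]) (use S dist in auto)
  then obtain n3 where n3: "?L3 = {x. orthogonal n3 x}" ..
  have "card {n1, n2, n3} \<le> 3" by (simp add: card_insert_if)
  then have "dim {n1, n2, n3} < DIM(real ^ 4)"
    using dim_le_card'[of "{n1, n2, n3}"] by simp
  then obtain v where v: "v \<noteq> 0" "\<And>y. y \<in> span {n1, n2, n3} \<Longrightarrow> orthogonal v y"
    using orthogonal_to_subspace_exists by blast
  have vL: "v \<in> ?L1" "v \<in> ?L2" "v \<in> ?L3"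
    unfolding n1 n2 n3 using v(2) by (auto simp: orthogonal_commute intro: span_base)
  have in_L: "x2 \<in> ?L1" "x3 \<in> ?L1" "x1 \<in> ?L2" "x3 \<in> ?L2" "x1 \<in> ?L3" "x2 \<in> ?L3"
    by (auto intro: span_base)
  have notin: "x1 \<notin> ?L1" "y2 \<notin> ?L1" "y3 \<notin> ?L1"
    "x2 \<notin> ?L2" "y1 \<notin> ?L2" "y3 \<notin> ?L2" "x3 \<notin> ?L3" "y1 \<notin> ?L3" "y2 \<notin> ?L3"
    using tuple(2) S dist by auto
  \<comment> \<open>Two of the three \<open>x\<close> and \<open>v\<close> itself lie in each hyperplane, the remaining \<open>x\<close> does not, so each
    coefficient of \<open>v\<close> with respect to the \<open>x\<close> vanishes in turn.\<close>
  have v_notin: "v \<notin> span {x1, x2, x3}"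
  proof
    assume "v \<in> span {x1, x2, x3}"
    then obtain a b c where abc: "v = a *\<^sub>R x1 + b *\<^sub>R x2 + c *\<^sub>R x3" by (auto simp: span_3_iff)
    have "a *\<^sub>R x1 = v - (b *\<^sub>R x2 + c *\<^sub>R x3)" "b *\<^sub>R x2 = v - (a *\<^sub>R x1 + c *\<^sub>R x3)"
      "c *\<^sub>R x3 = v - (a *\<^sub>R x1 + b *\<^sub>R x2)"
      using abc by (auto simp: algebra_simps)
    then have "a *\<^sub>R x1 \<in> ?L1" "b *\<^sub>R x2 \<in> ?L2" "c *\<^sub>R x3 \<in> ?L3"
      using vL in_L by (metis span_add span_diff span_scale)+
    then have "a = 0" "b = 0" "c = 0" using scaleR_in_span_cancel notin by blast+
    with abc v(1) show False by simp
  qed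
  then have v_pairs: "v \<notin> span {x1, x2}" "v \<notin> span {x1, x3}" "v \<notin> span {x2, x3}"
    using span_mono[of "{x1, x2}" "{x1, x2, x3}"] span_mono[of "{x1, x3}" "{x1, x2, x3}"]
      span_mono[of "{x2, x3}" "{x1, x2, x3}"] by auto
  define D where "D = {\<beta> v v, \<beta> v x1, \<beta> v x2, \<beta> v x3}"
  have mix: "\<beta> x2 x3 \<in> span D" "\<beta> x1 x3 \<in> span D" "\<beta> x1 x2 \<in> span D"
  proof -
    have "\<beta> x2 x3 \<in> span {\<beta> v v, \<beta> v x2, \<beta> v x3}"
      by (rule polar_value_in_span_apex[where M = ?L2 and N = ?L3 and r = y1])
        (use z vL in_L notin v_pairs in auto)
    then show "\<beta> x2 x3 \<in> span D"
      using span_mono[of "{\<beta> v v, \<beta> v x2, \<beta> v x3}" D] by (auto simp: D_def)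
    have "\<beta> x1 x3 \<in> span {\<beta> v v, \<beta> v x1, \<beta> v x3}"
      by (rule polar_value_in_span_apex[where M = ?L1 and N = ?L3 and r = y2])
        (use z vL in_L notin v_pairs in auto)
    then show "\<beta> x1 x3 \<in> span D"
      using span_mono[of "{\<beta> v v, \<beta> v x1, \<beta> v x3}" D] by (auto simp: D_def)
    have "\<beta> x1 x2 \<in> span {\<beta> v v, \<beta> v x1, \<beta> v x2}"
      by (rule polar_value_in_span_apex[where M = ?L1 and N = ?L2 and r = y3])
        (use z vL in_L notin v_pairs in auto)
    then show "\<beta> x1 x2 \<in> span D"
      using span_mono[of "{\<beta> v v, \<beta> v x1, \<beta> v x2}" D] by (auto simp: D_def)
  qed
  have basis: "span {v, x1, x2, x3} = UNIV"
  proof -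
    have x: "independent {x1, x2, x3}" "card {x1, x2, x3} = 3"
      using tuple(1)[of x1 x2 x3 y1] S dist by auto
    then have "independent {v, x1, x2, x3}" using v_notin by (simp add: independent_insertI)
    moreover have "card {v, x1, x2, x3} = 4"
      using x(2) v_notin by (subst card_insert_disjoint) (auto intro: span_base)
    ultimately show ?thesis
      using card_ge_dim_independent[of "{v, x1, x2, x3}" UNIV] by (auto simp: dim_UNIV)
  qed
  have values_in_D: "\<beta> x y \<in> span D" for x y
  proof (rule bilinear_values_in_span[OF \<beta>])
    show "x \<in> span {v, x1, x2, x3}" "y \<in> span {v, x1, x2, x3}" by (simp_all add: basis)
    fix b c assume "b \<in> {v, x1, x2, x3}" "c \<in> {v, x1, x2, x3}"
    then show "\<beta> b c \<in> span D"
      using mix z by (auto simp: D_def sym[of x1 v] sym[of x2 v] sym[of x3 v] sym[of x2 x1] sym[of x3 x1] sym[of x3 x2]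
          span_zero intro: span_base)
  qed
  have isotropic: "g (\<beta> v x) (\<beta> v y) = 0"
    if "x \<in> L" "y \<in> L" "L = ?L1 \<or> L = ?L2 \<or> L = ?L3" for x y L
  proof -
    have L1: "g (\<beta> v x) (\<beta> v y) = 0" if "x \<in> ?L1" "y \<in> ?L1"
      by (rule isotropic_on_plane[of x2 x3 y1]) (use z van vL that in auto)
    have L2: "g (\<beta> v x) (\<beta> v y) = 0" if "x \<in> ?L2" "y \<in> ?L2"
      by (rule isotropic_on_plane[of x1 x3 y2]) (use z van vL that in auto)
    have L3: "g (\<beta> v x) (\<beta> v y) = 0" if "x \<in> ?L3" "y \<in> ?L3"
      by (rule isotropic_on_plane[of x1 x2 y3]) (use z van vL that in auto)
    show ?thesis using that L1 L2 L3 by blast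
  qed
  have "g (\<beta> x x) (\<beta> x x) = 0"
  proof (rule bilinear_vanishes_on_span[OF g values_in_D values_in_D])
    fix a b assume "a \<in> D" "b \<in> D"
    then obtain x y where xy: "a = \<beta> v x" "b = \<beta> v y" "x \<in> {v, x1, x2, x3}" "y \<in> {v, x1, x2, x3}"
      by (auto simp: D_def)
    then have "(x \<in> ?L1 \<and> y \<in> ?L1) \<or> (x \<in> ?L2 \<and> y \<in> ?L2) \<or> (x \<in> ?L3 \<and> y \<in> ?L3)"
      using vL in_L by blast
    then show "g a b = 0" using isotropic xy(1,2) by blast
  qed
  then show ?thesis by (simp add: quartic_def)
qed

section \<open>The product of the four linear forms\<close>

lemma linear_forms_common_nonzero:
  fixes U :: "'a::euclidean_space set"
  assumes "finite U" "0 \<notin> U"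
  obtains x where "\<And>u. u \<in> U \<Longrightarrow> x \<bullet> u \<noteq> 0"
proof -
  have "negligible (\<Union>u\<in>U. {x. u \<bullet> x = 0})"
    using assms by (intro negligible_Union) (auto intro!: negligible_hyperplane)
  then have "(\<Union>u\<in>U. {x. u \<bullet> x = 0}) \<noteq> UNIV" by auto
  then obtain x where "x \<notin> (\<Union>u\<in>U. {x. u \<bullet> x = 0})" by blast
  then show ?thesis using that[of x] by (auto simp: inner_commute)
qed

text \<open>The three pairwise intersections of \<open>T 1\<close>, \<open>T 2\<close>, \<open>T 3\<close> are distinct singletons, because an
element of all three would be covered more than twice. Each triple thus consists of two of these
common elements and one that it shares with neither of the other two.\<close>

lemma double_covering_labels:
  assumes "double_covering T"
  obtains a1 a2 a3 b1 b2 b3 where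
    "distinct [a1, a2, a3, b1, b2, b3]" "{a1, a2, a3, b1, b2, b3} \<subseteq> {1..6}"
    "T 1 = {a2, a3, b1}" "T 2 = {a1, a3, b2}" "T 3 = {a1, a2, b3}"
proof -
  have T: "T i \<subseteq> {1..6}" "card (T i) = 3" if "i \<in> {1, 2, 3}" for i
    using assms that unfolding double_covering_def by force+
  have "card (T 1 \<inter> T 2) = 1" "card (T 1 \<inter> T 3) = 1" "card (T 2 \<inter> T 3) = 1"
    using assms unfolding double_covering_def by force+
  then obtain a1 a2 a3 where a: "T 1 \<inter> T 2 = {a3}" "T 1 \<inter> T 3 = {a2}" "T 2 \<inter> T 3 = {a1}"
    by (metis card_1_singletonE)
  have "T 1 \<inter> T 2 \<inter> T 3 = {}"
  proof (rule ccontr)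
    assume "T 1 \<inter> T 2 \<inter> T 3 \<noteq> {}"
    then obtain k where k: "k \<in> T 1" "k \<in> T 2" "k \<in> T 3" by blast
    then have "{1, 2, 3} \<subseteq> {i \<in> {1..4}. k \<in> T i}" by auto
    then have "card {1, 2, 3 :: nat} \<le> card {i \<in> {1..4}. k \<in> T i}" by (intro card_mono) auto
    moreover have "card {i \<in> {1..4}. k \<in> T i} = 2"
      using assms k(1) T(1)[of 1] unfolding double_covering_def by blast
    ultimately show False by simp
  qed
  then have neq: "a1 \<notin> T 1" "a2 \<notin> T 2" "a3 \<notin> T 3" using a by blast+
  have third: "\<exists>b. A = {p, q, b} \<and> b \<noteq> p \<and> b \<noteq> q" if "card A = 3" "p \<in> A" "q \<in> A" "p \<noteq> q" for A and p q :: nat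
    using that unfolding card_3_iff by auto
  have mem: "a3 \<in> T 1" "a3 \<in> T 2" "a2 \<in> T 1" "a2 \<in> T 3" "a1 \<in> T 2" "a1 \<in> T 3"
    using a by blast+
  obtain b1 where b1: "T 1 = {a2, a3, b1}" "b1 \<noteq> a2" "b1 \<noteq> a3"
    using third[of "T 1" a2 a3] T(2) mem neq by force
  obtain b2 where b2: "T 2 = {a1, a3, b2}" "b2 \<noteq> a1" "b2 \<noteq> a3"
    using third[of "T 2" a1 a3] T(2) mem neq by force
  obtain b3 where b3: "T 3 = {a1, a2, b3}" "b3 \<noteq> a1" "b3 \<noteq> a2"
    using third[of "T 3" a1 a2] T(2) mem neq by force
  show ?thesis
  proof
    show "distinct [a1, a2, a3, b1, b2, b3]" using a neq b1 b2 b3 by auto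
    show "{a1, a2, a3, b1, b2, b3} \<subseteq> {1..6}" using T(1) b1(1) b2(1) b3(1) by blast
  qed (use b1 b2 b3 in auto)
qed

theorem proposition6p4:
  fixes s :: "nat \<Rightarrow> real ^ 4"
    and S :: "(real ^ 4) set"
    and T :: "nat \<Rightarrow> nat set"
    and u :: "nat \<Rightarrow> real ^ 4"
    and R :: "real ^ 4 \<Rightarrow> real"
  assumes "inj_on s {1..6}"
    and "S = s ` {1..6}"
    and "general_linear_position S"
    and "double_covering T"
    and "unit_normals s T u"
    and "R = (\<lambda>x. (x \<bullet> u 1) * (x \<bullet> u 2) * (x \<bullet> u 3) * (x \<bullet> u 4))"
  shows "R \<notin> squares_span S"
proof
  assume R: "R \<in> squares_span S"
  obtain a1 a2 a3 b1 b2 b3 where ab: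
    "distinct [a1, a2, a3, b1, b2, b3]" "{a1, a2, a3, b1, b2, b3} \<subseteq> {1..6}"
    "T 1 = {a2, a3, b1}" "T 2 = {a1, a3, b2}" "T 3 = {a1, a2, b3}"
    using double_covering_labels[OF assms(4)] .
  have u: "norm (u i) = 1" "\<And>x. x \<in> span (s ` T i) \<Longrightarrow> x \<bullet> u i = 0" if "i \<in> {1..4}" for i
    using assms(5) that unfolding unit_normals_def orthogonal_def by (auto simp: inner_commute)
  obtain \<beta> :: "real ^ 4 \<Rightarrow> real ^ 4 \<Rightarrow> (real ^ 4 \<Rightarrow> real) \<Rightarrow> real" and g where
    gram: "gram_form \<beta> g" and \<beta>_zero: "\<forall>s\<in>S. \<beta> s s = 0" and quartic: "gram_form.quartic \<beta> g = R"
    using squares_span_gram_form[OF R] by blast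
  have "gram_form.quartic \<beta> g x = 0" for x
  proof (rule quartic_vanishing_on_three_hyperplanes[OF gram assms(3) \<beta>_zero])
    show "{s a1, s a2, s a3, s b1, s b2, s b3} \<subseteq> S" using ab(2) assms(2) by auto
    have "inj_on s (set [a1, a2, a3, b1, b2, b3])"
      by (rule inj_on_subset[OF assms(1)]) (use ab(2) in simp)
    then have "distinct (map s [a1, a2, a3, b1, b2, b3])"
      using ab(1) by (simp only: distinct_map)
    then show "distinct [s a1, s a2, s a3, s b1, s b2, s b3]" by simp
    fix x assume "x \<in> span {s a2, s a3, s b1} \<union> span {s a1, s a3, s b2} \<union> span {s a1, s a2, s b3}"
    then show "gram_form.quartic \<beta> g x = 0"
      using u(2)[of 1 x] u(2)[of 2 x] u(2)[of 3 x] ab(3-5) by (auto simp: quartic assms(6))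
  qed
  then have zero: "R x = 0" for x by (simp add: quartic)
  have "0 \<notin> u ` {1..4}" using u(1) by force
  then obtain x where "\<And>w. w \<in> u ` {1..4} \<Longrightarrow> x \<bullet> w \<noteq> 0"
    using linear_forms_common_nonzero[of "u ` {1..4}"] by auto
  then have "R x \<noteq> 0" by (simp add: assms(6))
  with zero show False by blast
qed

end
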